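(* Let $\mathbb{S}$ denote the set of skew-symmetric matrix polynomials in $\mathbb{P}_m(\mathbb{C}^{n\times n})$ and let $P\in\mathbb{S}$ be regular. Let $(\lambda,x)\in\mathbb{C}\times\mathbb{C}^n$ with $x^Hx=1$, and set $r:=-P(\lambda)x$ and $\Lambda_m:=[1,\lambda,\ldots,\lambda^m]^T$. Then $$\eta_F^{\mathbb{S}}(\lambda,x,P)=\sqrt2\,\eta(\lambda,x,P),\qquad \eta_2^{\mathbb{S}}(\lambda,x,P)=\eta(\lambda,x,P).$$ Moreover, for the skew-symmetric polynomial $\Delta P(z):=\sum_{j=0}^m z^j\Delta A_j$ with $\Delta A_j:=-\frac{\overline{\lambda^j}}{\|\Lambda_m\|_2^2}\left[\overline{x}r^T-rx^H\right]$, $j=0,\ldots,m$, we have $P(\lambda)x+\Delta P(\lambda)x=0$, $|||\Delta P|||_F=\eta_F^{\mathbb{S}}(\lambda,x,P)$ and $|||\Delta P|||_2=\eta_2^{\mathbb{S}}(\lambda,x,P)$.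
   Context: $m,n\ge1$ are integers. $\mathbb{P}_m(\mathbb{C}^{n\times n})$ is the vector space of matrix polynomials $P(z)=\sum_{j=0}^m z^jA_j$ with $A_j\in\mathbb{C}^{n\times n}$ (degree at most $m$). $P$ is regular if $\det P(z)\ne0$ for some $z\in\mathbb{C}$. $P$ is skew-symmetric if $P(z)^T=-P(z)$ for all $z$, i.e. all $A_j^T=-A_j$. Bars denote entrywise complex conjugation. For $M\in\{2,F\}$, $|||P|||_M:=\left(\sum_{j=0}^m\|A_j\|_M^2\right)^{1/2}$, where $\|\cdot\|_F$ is the Frobenius norm and $\|\cdot\|_2$ the spectral norm. For $P$ regular, $\lambda\in\mathbb{C}$ and $x\in\mathbb{C}^n$ with $x^Hx=1$, the unstructured backward error is $\eta(\lambda,x,P):=\inf\{|||\Delta P|||_M:\Delta P\in\mathbb{P}_m(\mathbb{C}^{n\times n}),\ P(\lambda)x+\Delta P(\lambda)x=0\}$, which equals $\|P(\lambda)x\|_2/\|\Lambda_m\|_2$ for both $M=2$ and $M=F$. For $P\in\mathbb{S}$ the structured backward error is $\eta_M^{\mathbb{S}}(\lambda,x,P):=\inf\{|||\Delta P|||_M:\Delta P\in\mathbb{S},\ P(\lambda)x+\Delta P(\lambda)x=0\}$. *)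

theory Defs
  imports "HOL-Analysis.Analysis" "HOL-Computational_Algebra.Polynomial"
begin

definition cmat_scale :: "complex \<Rightarrow> complex^'n^'n \<Rightarrow> complex^'n^'n" where
  "cmat_scale c A = map_matrix ((*) c) A"

definition vec_cnj :: "complex^'n \<Rightarrow> complex^'n" where
  "vec_cnj x = (\<chi> i. cnj (x $ i))"

text \<open>The product u v^T of a column by a row, with no conjugation.\<close>

definition outer_prod :: "complex^'n \<Rightarrow> complex^'n \<Rightarrow> complex^'n^'n" where
  "outer_prod u v = (\<chi> i j. u $ i * v $ j)"

text \<open>
  A matrix polynomial is a polynomial with matrix coefficients. The library function
  \<^const>\<open>poly\<close> is not used for evaluation: on \<open>complex^'n^'n\<close> the operation \<open>*\<close> is the
  entrywise product, and the argument here is a scalar.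
\<close>

type_synonym 'n matpoly = "(complex^'n^'n) poly"

definition matpoly_eval :: "'n::finite matpoly \<Rightarrow> complex \<Rightarrow> complex^'n^'n" where
  "matpoly_eval P z = (\<Sum>j\<le>degree P. cmat_scale (z ^ j) (coeff P j))"

definition matpolys :: "nat \<Rightarrow> 'n::finite matpoly set" where
  "matpolys m = {P. degree P \<le> m}"

definition regular_matpoly :: "'n::finite matpoly \<Rightarrow> bool" where
  "regular_matpoly P \<longleftrightarrow> (\<exists>z. det (matpoly_eval P z) \<noteq> 0)"

definition skew_symmetric_matpolys :: "nat \<Rightarrow> 'n::finite matpoly set" where
  "skew_symmetric_matpolys m =
     {P \<in> matpolys m. \<forall>z. transpose (matpoly_eval P z) = - matpoly_eval P z}"

datatype norm_kind = Spectral | Frobenius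

text \<open>The spectral norm is the operator norm induced by the Euclidean norm of \<open>complex^'n\<close>.\<close>

fun mat_norm :: "norm_kind \<Rightarrow> complex^'n^'n \<Rightarrow> real" where
  "mat_norm Spectral A = onorm ((*v) A)"
| "mat_norm Frobenius A = sqrt (\<Sum>i\<in>UNIV. \<Sum>j\<in>UNIV. (cmod (A $ i $ j))\<^sup>2)"

definition matpoly_norm :: "norm_kind \<Rightarrow> nat \<Rightarrow> 'n::finite matpoly \<Rightarrow> real" where
  "matpoly_norm M m P = sqrt (\<Sum>j\<le>m. (mat_norm M (coeff P j))\<^sup>2)"

text \<open>
  \<open>Inf\<close> on the reals is unspecified on the empty set. For \<open>x \<noteq> 0\<close> the set below is
  nonempty when \<open>S = matpolys m\<close>, and also when \<open>S = skew_symmetric_matpolys m\<close> and \<open>P \<in> S\<close>.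
\<close>

definition structured_backward_error ::
  "norm_kind \<Rightarrow> nat \<Rightarrow> 'n::finite matpoly set \<Rightarrow> complex \<Rightarrow> complex^'n \<Rightarrow> 'n matpoly \<Rightarrow> real" where
  "structured_backward_error M m S lam x P =
     Inf {matpoly_norm M m D | D. D \<in> S \<and> matpoly_eval P lam *v x + matpoly_eval D lam *v x = 0}"

definition backward_error ::
  "norm_kind \<Rightarrow> nat \<Rightarrow> complex \<Rightarrow> complex^'n::finite \<Rightarrow> 'n matpoly \<Rightarrow> real" where
  "backward_error M m lam x P = structured_backward_error M m (matpolys m) lam x P"

text \<open>The Euclidean norm of the vector \<open>[1, lam, ..., lam^m]\<close>.\<close>

definition Lambda_norm :: "nat \<Rightarrow> complex \<Rightarrow> real" where
  "Lambda_norm m lam = L2_set (\<lambda>j. cmod (lam ^ j)) {..m}"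

end

theory Submission
  imports Defs
begin

text \<open>
  If \<open>D\<close> solves \<open>D(\<lambda>) x = r\<close>, the Cauchy--Schwarz inequality over the coefficients bounds
  \<open>\<parallel>r\<parallel>\<close> by \<open>\<parallel>\<Lambda>\<^sub>m\<parallel> |||D|||\<close>, and equality holds when the coefficients are proportional to
  \<open>cnj (\<lambda>\<^sup>j)\<close> with a matrix \<open>E\<close> of minimal norm subject to \<open>E x = r\<close>. So the problem reduces to a
  single matrix: \<open>E = r x\<^sup>H\<close> without structure, and \<open>E = r x\<^sup>H - cnj x r\<^sup>T\<close> in the skew-symmetric
  case, where \<open>x\<^sup>T r = 0\<close>. By Bessel's inequality the latter has spectral norm \<open>\<parallel>r\<parallel>\<close>; its Frobenius
  norm is \<open>sqrt 2 * \<parallel>r\<parallel>\<close>, which is optimal since the inner product of \<open>E\<close> with any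
  skew-symmetric \<open>A\<close> such that \<open>A x = r\<close> equals \<open>2 \<parallel>r\<parallel>\<^sup>2\<close>.
\<close>

subsection \<open>Dyads and their norms\<close>

lemma scalar_product_commute:
  "scalar_product u v = scalar_product v (u :: 'a::comm_semiring_1^'n)"
  by (simp add: scalar_product_def mult.commute)

lemma scalar_product_diff_right:
  "scalar_product u (v - w) = scalar_product u v - scalar_product u (w :: 'a::ring_1^'n)"
  by (simp add: scalar_product_def right_diff_distrib sum_subtractf)

lemma scalar_product_mult_right:
  "scalar_product u (c *s v) = c * scalar_product u (v :: 'a::comm_semiring_1^'n)"
  by (simp add: scalar_product_def sum_distrib_left mult_ac)

lemma scalar_product_minus_right:
  "scalar_product u (- v) = - scalar_product u (v :: 'a::ring_1^'n)"
  by (simp add: scalar_product_def sum_negf)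

lemma scalar_product_transpose:
  "scalar_product u (A *v v) = scalar_product (transpose A *v u) (v :: 'a::comm_semiring_1^'n)"
proof -
  have "scalar_product u (A *v v) = (\<Sum>i\<in>UNIV. \<Sum>j\<in>UNIV. u $ i * (A $ i $ j * v $ j))"
    by (simp add: scalar_product_def matrix_vector_mult_def sum_distrib_left)
  also have "\<dots> = (\<Sum>j\<in>UNIV. \<Sum>i\<in>UNIV. u $ i * (A $ i $ j * v $ j))"
    by (rule sum.swap)
  also have "\<dots> = scalar_product (transpose A *v u) v"
    by (simp add: scalar_product_def matrix_vector_mult_def transpose_def sum_distrib_left sum_distrib_right
        mult_ac)
  finally show ?thesis .
qed

lemma vec_cnj_vec_cnj [simp]: "vec_cnj (vec_cnj x) = x"
  by (simp add: vec_cnj_def vec_eq_iff)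

lemma norm_vec_cnj [simp]: "norm (vec_cnj x) = norm x"
  by (simp add: norm_vec_def vec_cnj_def)

lemma scalar_product_vec_cnj: "scalar_product (vec_cnj u) (vec_cnj v) = cnj (scalar_product u v)"
  by (simp add: scalar_product_def vec_cnj_def)

lemma inner_eq_Re_scalar_product: "u \<bullet> v = Re (scalar_product u (vec_cnj v))"
  for u v :: "complex^'n"
  by (simp add: inner_vec_def scalar_product_def vec_cnj_def inner_complex_def)

lemma scalar_product_vec_cnj_self: "scalar_product x (vec_cnj x) = of_real ((norm x)\<^sup>2)"
proof -
  have "Im (scalar_product x (vec_cnj x)) = 0"
    by (simp add: scalar_product_def vec_cnj_def)
  then show ?thesis
    by (simp add: complex_eq_iff power2_norm_eq_inner inner_eq_Re_scalar_product)
qed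

lemma cmod_scalar_product_le: "cmod (scalar_product u v) \<le> norm u * norm v"
proof -
  have "cmod (scalar_product u v) \<le> (\<Sum>i\<in>UNIV. \<bar>cmod (u $ i)\<bar> * \<bar>cmod (v $ i)\<bar>)"
    unfolding scalar_product_def by (rule order_trans[OF norm_sum]) (simp add: norm_mult)
  also have "\<dots> \<le> norm u * norm v"
    unfolding norm_vec_def by (rule L2_set_mult_ineq)
  finally show ?thesis .
qed

lemma norm_vector_scalar_mult: "norm (c *s v) = cmod c * norm (v :: complex^'n)"
  by (simp add: norm_vec_def norm_mult L2_set_right_distrib)

lemma outer_prod_mult_vector: "outer_prod u v *v w = scalar_product v w *s u"
  by (simp add: outer_prod_def matrix_vector_mult_def scalar_product_def vec_eq_iff
      sum_distrib_left mult_ac)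

text \<open>The inner product of the type \<open>complex^'n^'n\<close> is the real part of the
  Frobenius inner product. Against a dyad it collapses to a single matrix-vector product, which
  makes norms and orthogonality of dyads computable.\<close>

lemma inner_outer_prod:
  "A \<bullet> outer_prod u v = Re (scalar_product (vec_cnj u) (A *v vec_cnj v))"
  by (simp add: inner_vec_def scalar_product_def vec_cnj_def outer_prod_def inner_complex_def
      matrix_vector_mult_def sum_distrib_left algebra_simps sum_subtractf sum.distrib)

lemma norm_outer_prod: "norm (outer_prod u v) = norm u * norm v"
proof -
  have "(norm (outer_prod u v))\<^sup>2 = (norm u * norm v)\<^sup>2"
    unfolding power2_norm_eq_inner inner_outer_prod
    by (simp add: outer_prod_mult_vector scalar_product_mult_right scalar_product_vec_cnj_self
        scalar_product_commute[of "vec_cnj u"] power_mult_distrib flip: of_real_power of_real_mult)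
  then show ?thesis
    by simp
qed

lemma mat_norm_Frobenius_eq_norm: "mat_norm Frobenius A = norm A"
  by (simp add: norm_vec_def L2_set_def sum_nonneg)

lemma mat_norm_nonneg: "0 \<le> mat_norm M A"
  by (cases M) (simp_all add: onorm_pos_le sum_nonneg)

lemma norm_mult_vector_le_Frobenius: "norm (A *v x) \<le> norm A * norm x"
  for A :: "complex^'n^'n"
proof -
  have "norm (A *v x) \<le> L2_set (\<lambda>i. norm (A $ i) * norm x) UNIV"
    unfolding norm_vec_def[of "A *v x"]
    by (intro L2_set_mono)
      (auto simp: matrix_vector_mult_def simp flip: scalar_product_def intro: cmod_scalar_product_le)
  also have "\<dots> = norm A * norm x"
    by (simp add: norm_vec_def[of A] L2_set_left_distrib)
  finally show ?thesis .
qed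

lemma norm_mult_vector_le: "norm (A *v x) \<le> mat_norm M A * norm x"
  by (cases M)
    (simp_all only: mat_norm.simps(1) mat_norm_Frobenius_eq_norm norm_mult_vector_le_Frobenius
      onorm matrix_vector_mul_bounded_linear)

lemma mat_norm_Spectral_le_Frobenius: "mat_norm Spectral A \<le> mat_norm Frobenius A"
  unfolding mat_norm.simps(1) mat_norm_Frobenius_eq_norm
  by (rule onorm_bound) (simp_all add: norm_mult_vector_le_Frobenius)

lemma cmat_scale_mult_vector: "cmat_scale c A *v v = c *s (A *v v)"
  by (simp add: cmat_scale_def matrix_vector_mult_def vec_eq_iff sum_distrib_left mult_ac)

lemma mat_norm_scale_le: "mat_norm M (cmat_scale c A) \<le> cmod c * mat_norm M A"
proof (cases M)
  case Spectral
  have "norm (cmat_scale c A *v v) \<le> cmod c * mat_norm Spectral A * norm v" for v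
    by (simp add: cmat_scale_mult_vector norm_vector_scalar_mult mult.assoc mult_left_mono
        norm_mult_vector_le[where M = Spectral, simplified])
  then show ?thesis
    by (simp add: Spectral onorm_bound onorm_pos_le)
next
  case Frobenius
  then show ?thesis
    by (simp add: cmat_scale_def norm_mult power_mult_distrib real_sqrt_mult
        flip: sum_distrib_left)
qed

text \<open>A dyad has at most one nonzero singular value, so the choice of norm does not matter.
  The upper bound is the Frobenius norm; the lower bound comes from testing at
  \<open>vec_cnj v\<close>.\<close>

lemma mat_norm_outer_prod: "mat_norm M (outer_prod u v) = norm u * norm v"
proof (rule antisym)
  show "mat_norm M (outer_prod u v) \<le> norm u * norm v"
    using mat_norm_Spectral_le_Frobenius[of "outer_prod u v"]
    by (cases M) (simp_all only: mat_norm_Frobenius_eq_norm norm_outer_prod order_refl)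
  show "norm u * norm v \<le> mat_norm M (outer_prod u v)"
  proof (cases "v = 0")
    case False
    have "norm u * norm v * norm v = norm (outer_prod u v *v vec_cnj v)"
      by (simp add: outer_prod_mult_vector scalar_product_vec_cnj_self norm_vector_scalar_mult
          norm_mult power2_eq_square)
    also have "\<dots> \<le> mat_norm M (outer_prod u v) * norm v"
      using norm_mult_vector_le[of "outer_prod u v" "vec_cnj v" M] by simp
    finally show ?thesis
      using False by simp
  qed (simp add: mat_norm_nonneg)
qed

section \<open>Wedge products u v^T - v u^T, and the norms of skew-symmetric matrices\<close>

definition skew_outer :: "complex^'n \<Rightarrow> complex^'n \<Rightarrow> complex^'n^'n" where
  "skew_outer u v = outer_prod u v - outer_prod v u"

lemma transpose_skew_outer: "transpose (skew_outer u v) = - skew_outer u v"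
  by (simp add: skew_outer_def outer_prod_def transpose_def vec_eq_iff)

lemma skew_outer_mult_vector:
  "skew_outer u v *v w = scalar_product v w *s u - scalar_product u w *s v"
  by (simp add: skew_outer_def matrix_vector_mult_diff_rdistrib outer_prod_mult_vector)

text \<open>Since r^T x = 0, the two dyads are orthogonal matrices in the sense of the inner
  product, and both have norm \<open>norm r * norm x\<close>; Pythagoras gives the factor
  \<open>sqrt 2\<close>.\<close>

lemma Frobenius_norm_skew_outer:
  assumes "scalar_product r x = 0"
  shows "mat_norm Frobenius (skew_outer r (vec_cnj x)) = sqrt 2 * (norm r * norm x)"
proof -
  have "orthogonal (outer_prod r (vec_cnj x)) (- outer_prod (vec_cnj x) r)"
    by (simp add: orthogonal_def inner_outer_prod outer_prod_mult_vector scalar_product_mult_right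
        scalar_product_commute[of x] assms)
  from norm_add_Pythagorean[OF this]
  have "(norm (skew_outer r (vec_cnj x)))\<^sup>2 = (sqrt 2 * (norm r * norm x))\<^sup>2"
    by (simp add: skew_outer_def norm_outer_prod power_mult_distrib)
  then show ?thesis
    by (simp del: mat_norm.simps add: mat_norm_Frobenius_eq_norm)
qed

text \<open>Split v = a x + u with u orthogonal to x. The image a r - b \<open>vec_cnj x\<close> is
  a sum of orthogonal vectors with |b| \<le> \<open>norm r * norm u\<close>, so its squared norm is
  at most that of r times that of v. The vector x attains the bound.\<close>

lemma Spectral_norm_skew_outer:
  assumes "scalar_product r x = 0" and "norm x = 1"
  shows "mat_norm Spectral (skew_outer r (vec_cnj x)) = norm r"
proof (rule antisym)
  let ?E = "skew_outer r (vec_cnj x)"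
  have "norm (?E *v v) \<le> norm r * norm v" for v
  proof -
    define a where "a = scalar_product (vec_cnj x) v"
    define b where "b = scalar_product r v"
    define u where "u = v - a *s x"
    \<comment> \<open>Because r^T x = 0, only the component u enters b. Bounding b through
      \<open>norm v\<close> instead would only give \<open>sqrt 2 * norm r\<close>.\<close>
    have "b = scalar_product r u"
      by (simp add: b_def u_def scalar_product_diff_right scalar_product_mult_right assms)
    then have b: "(cmod b)\<^sup>2 \<le> (norm r)\<^sup>2 * (norm u)\<^sup>2"
      using cmod_scalar_product_le[of r u] by (simp flip: power_mult_distrib)
    have "scalar_product (vec_cnj x) u = 0"
      by (simp add: u_def scalar_product_diff_right scalar_product_mult_right
          scalar_product_commute[of "vec_cnj x" x] scalar_product_vec_cnj_self assms flip: a_def)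
    then have "scalar_product x (vec_cnj u) = 0"
      using scalar_product_vec_cnj[of "vec_cnj x" u] by simp
    then have "orthogonal (a *s x) u"
      by (simp add: orthogonal_def inner_eq_Re_scalar_product scalar_product_mult_right
          scalar_product_commute[of _ "vec_cnj u"])
    then have v: "(norm v)\<^sup>2 = (cmod a)\<^sup>2 + (norm u)\<^sup>2"
      using norm_add_Pythagorean[of "a *s x" u]
      by (simp add: u_def norm_vector_scalar_mult assms)
    have "vec_cnj (b *s vec_cnj x) = cnj b *s x"
      by (simp add: vec_cnj_def vec_eq_iff)
    \<comment> \<open>The bilinear relation r^T x = 0 says that r is orthogonal to
      \<open>vec_cnj x\<close> in the Hermitian sense.\<close>
    then have "(a *s r) \<bullet> (b *s vec_cnj x) = 0"
      by (simp add: inner_eq_Re_scalar_product scalar_product_mult_right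
          scalar_product_commute[of "a *s r" x] scalar_product_commute[of x r] assms)
    then have "orthogonal (a *s r) (- (b *s vec_cnj x))"
      by (simp add: orthogonal_def)
    from norm_add_Pythagorean[OF this]
    have "(norm (?E *v v))\<^sup>2 = (cmod a)\<^sup>2 * (norm r)\<^sup>2 + (cmod b)\<^sup>2"
      by (simp add: skew_outer_mult_vector norm_vector_scalar_mult power_mult_distrib assms
          flip: a_def b_def)
    also have "\<dots> \<le> (norm r * norm v)\<^sup>2"
      using b by (simp add: v power_mult_distrib algebra_simps)
    finally show ?thesis
      by (rule power2_le_imp_le) simp
  qed
  then show "mat_norm Spectral ?E \<le> norm r"
    by (simp add: onorm_bound)
  have "?E *v x = r"
    by (simp add: skew_outer_mult_vector scalar_product_commute[of "vec_cnj x"]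
        scalar_product_vec_cnj_self assms)
  then show "norm r \<le> mat_norm Spectral ?E"
    using norm_mult_vector_le[of ?E x Spectral] by (simp add: assms)
qed

text \<open>A scalar equals its transpose, so x^T A x = x^T A^T x = - x^T A x.\<close>

lemma skew_symmetric_quadratic_form:
  fixes A :: "complex^'n^'n"
  assumes "transpose A = - A"
  shows "scalar_product (A *v x) x = 0"
proof -
  have "transpose A *v x = - (A *v x)"
    by (simp add: assms matrix_vector_mult_def vec_eq_iff sum_negf)
  then have "scalar_product x (A *v x) = - scalar_product x (A *v x)"
    using scalar_product_transpose[of x A x]
    by (simp add: scalar_product_commute[of _ x] scalar_product_minus_right)
  then show ?thesis
    unfolding scalar_product_commute[of _ x]
    by simp
qed

text \<open>The column A x = s also fixes the row x^T A = - s^T. Cauchy-Schwarz against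
  \<open>skew_outer s (vec_cnj x)\<close>, whose norm is \<open>sqrt 2 * norm s\<close>, exploits
  both.\<close>

lemma skew_symmetric_Frobenius_lower_bound:
  fixes A :: "complex^'n^'n"
  assumes "transpose A = - A" and "norm x = 1"
  shows "sqrt 2 * norm (A *v x) \<le> mat_norm Frobenius A"
proof -
  define s where "s = A *v x"
  have s: "scalar_product s x = 0"
    unfolding s_def by (rule skew_symmetric_quadratic_form[OF assms(1)])
  have "transpose A *v x = - s"
    by (simp add: assms(1) s_def matrix_vector_mult_def vec_eq_iff sum_negf)
  \<comment> \<open>This is the pairing of A with the second dyad. That dyad is subtracted, so it
    contributes as much as the first and doubles the inner product.\<close>
  then have "scalar_product x (A *v vec_cnj s) = - of_real ((norm s)\<^sup>2)"
    by (simp add: scalar_product_transpose scalar_product_commute[of _ "vec_cnj s"]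
        scalar_product_minus_right)
      (simp add: scalar_product_commute[of "vec_cnj s"] scalar_product_vec_cnj_self)
  then have "A \<bullet> skew_outer s (vec_cnj x) = 2 * (norm s)\<^sup>2"
    by (simp add: skew_outer_def inner_diff_right inner_outer_prod
        scalar_product_commute[of "vec_cnj s"] scalar_product_vec_cnj_self flip: s_def)
  then have "2 * (norm s)\<^sup>2 \<le> norm A * (sqrt 2 * norm s)"
    using norm_cauchy_schwarz[of A "skew_outer s (vec_cnj x)"] Frobenius_norm_skew_outer[OF s]
    by (simp only: mat_norm_Frobenius_eq_norm assms(2) mult_1_right)
  moreover have "2 * (norm s)\<^sup>2 = (sqrt 2 * norm s) * (sqrt 2 * norm s)"
    by (simp add: power2_eq_square)
  ultimately have "sqrt 2 * norm s \<le> norm A"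
    by (cases "s = 0") (simp_all only: mult_le_cancel_right_pos zero_less_mult_iff
        real_sqrt_gt_0_iff zero_less_norm_iff, simp_all)
  then show ?thesis
    by (simp only: mat_norm_Frobenius_eq_norm s_def)
qed

subsection \<open>Evaluation and norm of matrix polynomials\<close>

lemma matpoly_eval_altdef:
  assumes "degree P \<le> m"
  shows "matpoly_eval P z = (\<Sum>j\<le>m. cmat_scale (z ^ j) (coeff P j))"
  unfolding matpoly_eval_def using assms
  by (intro sum.mono_neutral_left)
    (auto simp: coeff_eq_0 cmat_scale_def vec_eq_iff)

lemma matpoly_eval_mult_vector:
  assumes "degree P \<le> m"
  shows "matpoly_eval P z *v v = (\<Sum>j\<le>m. z ^ j *s (coeff P j *v v))"
proof -
  have "(\<Sum>j\<in>I. B j) *v v = (\<Sum>j\<in>I. B j *v v)" for B :: "nat \<Rightarrow> complex^'a^'a" and I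
    by (induction I rule: infinite_finite_induct) (simp_all add: matrix_vector_mult_add_rdistrib)
  then show ?thesis
    by (simp add: matpoly_eval_altdef[OF assms] cmat_scale_mult_vector)
qed

text \<open>Reduces evaluation, entry by entry, to scalar polynomials, where the identity theorem is
  available.\<close>

lemma poly_map_poly_entry:
  "poly (map_poly (\<lambda>A. A $ i $ j) P) z = matpoly_eval P z $ i $ j"
proof -
  let ?p = "map_poly (\<lambda>A. A $ i $ j) P"
  have "degree ?p \<le> degree P"
    by (rule degree_le) (simp add: coeff_map_poly coeff_eq_0)
  \<comment> \<open>An entry may have smaller degree than P; the additional coefficients
    vanish.\<close>
  then have "poly ?p z = (\<Sum>k\<le>degree P. coeff ?p k * z ^ k)"
    unfolding poly_altdef by (intro sum.mono_neutral_left) (auto simp: coeff_eq_0)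
  also have "\<dots> = (\<Sum>k\<le>degree P. coeff P k $ i $ j * z ^ k)"
    by (simp add: coeff_map_poly)
  finally show ?thesis
    by (simp add: matpoly_eval_def cmat_scale_def mult.commute)
qed

text \<open>Complex polynomials that agree at all points have equal coefficients, so the pointwise
  condition of the definition passes to each coefficient, where the matrix bounds apply.\<close>

lemma skew_symmetric_matpolys_iff:
  "P \<in> skew_symmetric_matpolys m \<longleftrightarrow>
    degree P \<le> m \<and> (\<forall>k. transpose (coeff P k) = - coeff P k)"
proof -
  let ?p = "\<lambda>i j. map_poly (\<lambda>A. A $ i $ j) P"
  have "(\<forall>z. transpose (matpoly_eval P z) = - matpoly_eval P z) \<longleftrightarrow>
      (\<forall>i j z. poly (?p j i) z = poly (- ?p i j) z)"
    by (auto simp: vec_eq_iff transpose_def poly_map_poly_entry)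
  also have "\<dots> \<longleftrightarrow> (\<forall>i j. ?p j i = - ?p i j)"
    by (simp only: poly_eq_poly_eq_iff flip: fun_eq_iff)
  also have "\<dots> \<longleftrightarrow> (\<forall>k. transpose (coeff P k) = - coeff P k)"
    by (simp add: poly_eq_iff vec_eq_iff transpose_def coeff_map_poly) blast
  finally show ?thesis
    by (simp add: skew_symmetric_matpolys_def matpolys_def)
qed

section \<open>The Cauchy-Schwarz bound over the coefficients and the interpolant that attains
  it\<close>

lemma Lambda_norm_pos: "0 < Lambda_norm m lam"
proof -
  \<comment> \<open>The index 0 contributes 1, even for \<open>lam = 0\<close>.\<close>
  have "cmod (lam ^ 0) \<le> Lambda_norm m lam"
    unfolding Lambda_norm_def by (rule member_le_L2_set) auto
  then show ?thesis
    by simp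
qed

lemma matpoly_norm_altdef: "matpoly_norm M m P = L2_set (\<lambda>j. mat_norm M (coeff P j)) {..m}"
  by (simp add: matpoly_norm_def L2_set_def)

text \<open>The factor k transports a bound for single matrices to polynomials: k = 1 holds for
  every matrix and a unit vector v, and k = \<open>sqrt 2\<close> for skew-symmetric coefficients in
  the Frobenius norm.\<close>

lemma norm_matpoly_eval_mult_vector_le:
  assumes "degree P \<le> m"
    and "\<And>j. k * norm (coeff P j *v v) \<le> mat_norm M (coeff P j)" and "0 \<le> k"
  shows "k * norm (matpoly_eval P z *v v) \<le> Lambda_norm m z * matpoly_norm M m P"
proof -
  have "k * norm (matpoly_eval P z *v v) \<le> (\<Sum>j\<le>m. k * norm (z ^ j *s (coeff P j *v v)))"
    unfolding matpoly_eval_mult_vector[OF assms(1)] sum_distrib_left[symmetric]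
    using assms(3) by (intro mult_left_mono norm_sum)
  also have "\<dots> = (\<Sum>j\<le>m. cmod (z ^ j) * (k * norm (coeff P j *v v)))"
    by (simp add: norm_vector_scalar_mult mult_ac)
  also have "\<dots> \<le> (\<Sum>j\<le>m. \<bar>cmod (z ^ j)\<bar> * \<bar>mat_norm M (coeff P j)\<bar>)"
    using assms(2) by (intro sum_mono) (simp add: mat_norm_nonneg mult_left_mono)
  also have "\<dots> \<le> Lambda_norm m z * matpoly_norm M m P"
    unfolding Lambda_norm_def matpoly_norm_altdef by (rule L2_set_mult_ineq)
  finally show ?thesis .
qed

text \<open>The weights are the least-norm solution w of \<Sum> lam^j w_j = 1. Being proportional to
  the conjugated powers of \<open>lam\<close>, they give equality in Cauchy-Schwarz.\<close>

definition interpolant :: "nat \<Rightarrow> complex \<Rightarrow> complex^'n^'n \<Rightarrow> 'n::finite matpoly" where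
  "interpolant m lam E =
    (\<Sum>j\<le>m. monom (cmat_scale (cnj (lam ^ j) / of_real ((Lambda_norm m lam)\<^sup>2)) E) j)"

lemma coeff_interpolant:
  "coeff (interpolant m lam E) j =
    (if j \<le> m then cmat_scale (cnj (lam ^ j) / of_real ((Lambda_norm m lam)\<^sup>2)) E else 0)"
  by (simp add: interpolant_def coeff_sum)

lemma degree_interpolant: "degree (interpolant m lam E) \<le> m"
  by (rule degree_le) (simp add: coeff_interpolant)

lemma matpoly_eval_interpolant_mult_vector:
  "matpoly_eval (interpolant m lam E) lam *v v = E *v v"
proof -
  let ?L = "Lambda_norm m lam"
  have "(\<Sum>j\<le>m. lam ^ j * cnj (lam ^ j)) = of_real (?L\<^sup>2)"
    unfolding Lambda_norm_def L2_set_def complex_norm_square[symmetric]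
    by (simp add: sum_nonneg del: complex_cnj_power)
  then have "(\<Sum>j\<le>m. lam ^ j * (cnj (lam ^ j) / of_real (?L\<^sup>2))) = 1"
    using Lambda_norm_pos[of m lam] by (simp flip: sum_divide_distrib)
  then show ?thesis
    by (simp add: matpoly_eval_mult_vector[OF degree_interpolant] coeff_interpolant
        cmat_scale_mult_vector vec_eq_iff flip: sum_distrib_right times_divide_eq_left)
qed

lemma interpolant_skew_symmetric:
  assumes "transpose E = - E"
  shows "interpolant m lam E \<in> skew_symmetric_matpolys m"
proof -
  have "transpose (cmat_scale c E) = cmat_scale c (transpose E)" for c
    by (simp add: cmat_scale_def transpose_def vec_eq_iff)
  then have "transpose (cmat_scale c E) = - cmat_scale c E" for c
    by (simp add: assms cmat_scale_def vec_eq_iff)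
  moreover have "transpose 0 = - (0 :: complex^'a^'a)"
    by (simp add: transpose_def vec_eq_iff)
  ultimately show ?thesis
    by (simp add: skew_symmetric_matpolys_iff degree_interpolant coeff_interpolant)
qed

lemma matpoly_norm_interpolant_le:
  "matpoly_norm M m (interpolant m lam E) \<le> mat_norm M E / Lambda_norm m lam"
proof -
  let ?L = "Lambda_norm m lam"
  have "matpoly_norm M m (interpolant m lam E)
      \<le> L2_set (\<lambda>j. cmod (lam ^ j) * (mat_norm M E / ?L\<^sup>2)) {..m}"
    unfolding matpoly_norm_altdef
  proof (rule L2_set_mono)
    fix j
    assume "j \<in> {..m}"
    then show "mat_norm M (coeff (interpolant m lam E) j)
        \<le> cmod (lam ^ j) * (mat_norm M E / ?L\<^sup>2)"
      using mat_norm_scale_le[of M "cnj (lam ^ j) / of_real (?L\<^sup>2)" E]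
      by (simp add: coeff_interpolant norm_divide norm_power)
  qed (simp add: mat_norm_nonneg)
  also have "\<dots> = ?L * (mat_norm M E / ?L\<^sup>2)"
    unfolding Lambda_norm_def by (rule L2_set_left_distrib[symmetric]) (simp add: mat_norm_nonneg)
  also have "\<dots> = mat_norm M E / ?L"
    by (simp add: power2_eq_square)
  finally show ?thesis .
qed

text \<open>A squeeze: the interpolant of E is feasible with norm at most the claimed value, and
  \<open>lower\<close> puts every feasible D at or above it. So the infimum is an attained minimum.
  It serves the unstructured error and both structured ones.\<close>

lemma structured_backward_error_interpolant:
  assumes "interpolant m lam E \<in> S"
    and "matpoly_eval P lam *v x + E *v x = 0"
    and lower: "\<And>D. D \<in> S \<Longrightarrow> matpoly_eval P lam *v x + matpoly_eval D lam *v x = 0 \<Longrightarrow>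
      mat_norm M E \<le> Lambda_norm m lam * matpoly_norm M m D"
  shows "structured_backward_error M m S lam x P = mat_norm M E / Lambda_norm m lam"
    and "matpoly_norm M m (interpolant m lam E) = mat_norm M E / Lambda_norm m lam"
proof -
  let ?D = "interpolant m lam E" and ?\<eta> = "mat_norm M E / Lambda_norm m lam"
  have D: "matpoly_eval P lam *v x + matpoly_eval ?D lam *v x = 0"
    using assms(2) by (simp add: matpoly_eval_interpolant_mult_vector)
  have lower': "?\<eta> \<le> matpoly_norm M m D"
    if "D \<in> S" "matpoly_eval P lam *v x + matpoly_eval D lam *v x = 0" for D
    using lower[OF that] Lambda_norm_pos[of m lam] by (simp add: divide_le_eq mult.commute)
  show norm: "matpoly_norm M m ?D = ?\<eta>"
    by (rule antisym[OF matpoly_norm_interpolant_le lower'[OF assms(1) D]])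
  show "structured_backward_error M m S lam x P = ?\<eta>"
    unfolding structured_backward_error_def
    by (rule cInf_eq_minimum) (use assms(1) D norm lower' in \<open>force+\<close>)
qed

theorem theorem3p5:
  fixes m :: nat
    and P \<Delta>P :: "'n::finite matpoly"
    and lam :: complex
    and x r :: "complex^'n"
    and \<Delta>A :: "nat \<Rightarrow> complex^'n^'n"
    and S :: "'n matpoly set"
  assumes "m \<ge> 1"
    and "S = skew_symmetric_matpolys m"
    and "P \<in> S"
    and "regular_matpoly P"
    and "scalar_product (vec_cnj x) x = 1"
    and "r = - (matpoly_eval P lam *v x)"
    and "\<And>j. \<Delta>A j =
          cmat_scale (- cnj (lam ^ j) / of_real ((Lambda_norm m lam)\<^sup>2))
            (outer_prod (vec_cnj x) r - outer_prod r (vec_cnj x))"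
    and "\<Delta>P = (\<Sum>j\<le>m. monom (\<Delta>A j) j)"
  shows "(\<forall>M. structured_backward_error Frobenius m S lam x P = sqrt 2 * backward_error M m lam x P)
    \<and> (\<forall>M. structured_backward_error Spectral m S lam x P = backward_error M m lam x P)
    \<and> \<Delta>P \<in> S
    \<and> matpoly_eval P lam *v x + matpoly_eval \<Delta>P lam *v x = 0
    \<and> matpoly_norm Frobenius m \<Delta>P = structured_backward_error Frobenius m S lam x P
    \<and> matpoly_norm Spectral m \<Delta>P = structured_backward_error Spectral m S lam x P"
proof -
  have x: "norm x = 1"
    using assms(5) scalar_product_vec_cnj_self[of x]
    by (simp add: scalar_product_commute[of x] abs_square_eq_1 flip: of_real_power)
  have P: "transpose (matpoly_eval P lam) = - matpoly_eval P lam"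
    using assms(2,3) by (simp add: skew_symmetric_matpolys_def)
  have r: "matpoly_eval P lam *v x = - r"
    by (simp add: assms(6))
  \<comment> \<open>The value P(lam) is itself skew-symmetric. This relation is what makes
    \<open>skew_outer r (vec_cnj x)\<close> map x to r.\<close>
  have rx: "scalar_product r x = 0"
    using skew_symmetric_quadratic_form[OF P, of x]
    by (simp add: r scalar_product_commute[of _ x] scalar_product_minus_right)
  have xx: "scalar_product (vec_cnj x) x = 1"
    by (rule assms(5))
  let ?G = "outer_prod r (vec_cnj x)" and ?E = "skew_outer r (vec_cnj x)"
  have G: "matpoly_eval P lam *v x + ?G *v x = 0"
    by (simp add: r outer_prod_mult_vector xx)
  have E: "matpoly_eval P lam *v x + ?E *v x = 0"
    unfolding skew_outer_mult_vector by (simp add: r xx rx)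
  have D: "matpoly_eval D lam *v x = r"
    if "matpoly_eval P lam *v x + matpoly_eval D lam *v x = 0" for D
    using that by (simp add: r)
  have lower: "norm r \<le> Lambda_norm m lam * matpoly_norm M m D"
    if "degree D \<le> m" "matpoly_eval P lam *v x + matpoly_eval D lam *v x = 0" for D M
    using norm_matpoly_eval_mult_vector_le[OF that(1), of 1 x M lam]
      norm_mult_vector_le[of _ x M] D[OF that(2)] by (simp add: x)
  \<comment> \<open>The dyad r x^H has norm \<open>norm r\<close> for either M, which matches
    \<open>lower\<close>.\<close>
  have unstructured: "backward_error M m lam x P = norm r / Lambda_norm m lam" for M
    unfolding backward_error_def
    by (subst structured_backward_error_interpolant(1)[OF _ G])
      (auto simp: matpolys_def degree_interpolant mat_norm_outer_prod x lower)
  have interpolant: "interpolant m lam ?E \<in> S"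
    by (simp add: assms(2) interpolant_skew_symmetric transpose_skew_outer)
  have Spectral: "mat_norm Spectral ?E \<le> Lambda_norm m lam * matpoly_norm Spectral m D"
    if "D \<in> S" "matpoly_eval P lam *v x + matpoly_eval D lam *v x = 0" for D
    using lower[of D Spectral] that
    by (simp only: Spectral_norm_skew_outer[OF rx x] assms(2) skew_symmetric_matpolys_iff)
  have Frobenius: "mat_norm Frobenius ?E \<le> Lambda_norm m lam * matpoly_norm Frobenius m D"
    if "D \<in> S" "matpoly_eval P lam *v x + matpoly_eval D lam *v x = 0" for D
  proof -
    have "degree D \<le> m" and "\<And>j. transpose (coeff D j) = - coeff D j"
      using that(1) by (simp_all add: assms(2) skew_symmetric_matpolys_iff)
    \<comment> \<open>Here k = \<open>sqrt 2\<close>: each coefficient of D is skew-symmetric, so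
      the Frobenius bound holds for it.\<close>
    then have "sqrt 2 * norm (matpoly_eval D lam *v x)
        \<le> Lambda_norm m lam * matpoly_norm Frobenius m D"
      by (intro norm_matpoly_eval_mult_vector_le skew_symmetric_Frobenius_lower_bound x) auto
    then show ?thesis
      by (simp only: Frobenius_norm_skew_outer[OF rx] x D[OF that(2)] mult_1_right)
  qed
  note F = structured_backward_error_interpolant[OF interpolant E Frobenius]
  note Sp = structured_backward_error_interpolant[OF interpolant E Spectral]
  \<comment> \<open>The leading minus sign is absorbed by swapping the two dyads.\<close>
  have "\<Delta>A j = cmat_scale (cnj (lam ^ j) / of_real ((Lambda_norm m lam)\<^sup>2)) ?E" for j
    by (simp add: assms(7) cmat_scale_def skew_outer_def vec_eq_iff algebra_simps)
  then have \<Delta>P: "\<Delta>P = interpolant m lam ?E"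
    by (simp add: assms(8) interpolant_def)
  show ?thesis
    unfolding \<Delta>P using F Sp interpolant E
    by (simp add: unstructured matpoly_eval_interpolant_mult_vector x
        Frobenius_norm_skew_outer[OF rx] Spectral_norm_skew_outer[OF rx x]
        del: mat_norm.simps)
qed

end
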